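(* Let $A\in\mathbb{R}^{n\times N}$, $\mathbf{b}\in\mathbb{R}^n$, $s$ a positive integer, $\mathcal{A}=\{\mathbf{x}\in\mathbb{R}^N:A\mathbf{x}=\mathbf{b}\}$ and $\mathcal{L}_s(\mathbb{R}^N)=\{\mathbf{x}\in\mathbb{R}^N:\|\mathbf{x}\|_0\le s\}$. Assume $$\mathcal{L}_s(\mathbb{R}^N)\cap\operatorname{Null}(A)=\{0\}$$ and that there is a solution $\mathbf{x}_\star\in\mathcal{L}_s(\mathbb{R}^N)\cap\mathcal{A}$. Then the alternating projection algorithm $$\mathbf{y}_k=\mathcal{P}_{\mathcal{L}_s}(\mathbf{x}_k),\qquad \mathbf{x}_{k+1}=\mathcal{P}_{\mathcal{A}}(\mathbf{y}_k)$$ converges linearly for any starting initial guess $\mathbf{x}_0\in\mathcal{A}$.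
   Context: $\|\mathbf{x}\|_0$ is the number of nonzero components of $\mathbf{x}$, and $\operatorname{Null}(A)$ is the null space of $A$. $\mathcal{P}_{\mathcal{A}}$ is the orthogonal projection onto the affine space $\mathcal{A}$. $\mathcal{P}_{\mathcal{L}_s}(\mathbf{x})$ is obtained by keeping $s$ components of $\mathbf{x}$ of largest magnitude and setting the $N-s$ smallest (in magnitude) components to zero. "Converges linearly" means: the sequence $(\mathbf{x}_k)$ has a limit $\bar{\mathbf{x}}$ and there are constants $C>0$, $c\in(0,1)$ with $\|\mathbf{x}_k-\bar{\mathbf{x}}\|\le C c^k$ for all $k\geq 0$. *)

theory Defs
  imports "HOL-Analysis.Analysis"
begin

definition l0_norm :: "real ^ 'N \<Rightarrow> nat" where
  "l0_norm x = card {i. x $ i \<noteq> 0}"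

definition sparse_vectors :: "nat \<Rightarrow> (real ^ 'N) set" where
  "sparse_vectors s = {x. l0_norm x \<le> s}"

definition Null :: "real ^ 'N ^ 'n \<Rightarrow> (real ^ 'N) set" where
  "Null A = {x. A *v x = 0}"

definition affine_solutions :: "real ^ 'N ^ 'n \<Rightarrow> real ^ 'n \<Rightarrow> (real ^ 'N) set" where
  "affine_solutions A b = {x. A *v x = b}"

text \<open>
  The projection onto the \<open>s\<close>-sparse vectors is multivalued: when entries tie in magnitude,
  the index set \<open>J\<close> of the kept components is not unique, and every admissible choice is allowed.
  For \<open>s \<ge> N\<close> nothing is discarded, hence the minimum.
\<close>
definition sparse_projections :: "nat \<Rightarrow> real ^ 'N \<Rightarrow> (real ^ 'N) set" where
  "sparse_projections s x =
     {\<chi> i. if i \<in> J then x $ i else 0 | J.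
        card J = min s CARD('N) \<and> (\<forall>i\<in>J. \<forall>j\<in>-J. \<bar>x $ j\<bar> \<le> \<bar>x $ i\<bar>)}"

text \<open>
  The orthogonal projection onto an affine space is the library's \<^const>\<open>closest_point\<close>,
  which is well defined because the space is nonempty, closed and convex.
\<close>
definition alternating_projections ::
    "real ^ 'N ^ 'n \<Rightarrow> real ^ 'n \<Rightarrow> nat \<Rightarrow> (nat \<Rightarrow> real ^ 'N) \<Rightarrow> (nat \<Rightarrow> real ^ 'N) \<Rightarrow> bool" where
  "alternating_projections A b s x y \<longleftrightarrow>
     (\<forall>k. y k \<in> sparse_projections s (x k) \<and>
          x (Suc k) = closest_point (affine_solutions A b) (y k))"

definition converges_linearly :: "(nat \<Rightarrow> 'a::real_normed_vector) \<Rightarrow> bool" where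
  "converges_linearly x \<longleftrightarrow>
     (\<exists>l. x \<longlonglongrightarrow> l \<and> (\<exists>C c. 0 < C \<and> 0 < c \<and> c < 1 \<and> (\<forall>k. norm (x k - l) \<le> C * c ^ k)))"

end

theory Submission
  imports Defs
begin

text \<open>
  For an index set \<open>J\<close> of at most \<open>s\<close> elements, let \<open>T\<^sub>J\<close> keep the entries in \<open>J\<close> and then
  project onto the affine space. The null space meets the coordinate subspace of \<open>J\<close> only in
  \<open>0\<close>, so \<open>T\<^sub>J\<close> is a contraction of the affine space; let \<open>p\<^sub>J\<close> be its fixed point. The iteration
  is \<open>x\<^sub>k\<^sub>+\<^sub>1 = T\<^sub>J x\<^sub>k\<close> with \<open>J\<close> depending on \<open>k\<close>. By Pythagoras, \<open>\<parallel>x\<^sub>k - y\<^sub>k\<parallel>\<^sup>2\<close> drops in each step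
  by at least \<open>\<parallel>x\<^sub>k\<^sub>+\<^sub>1 - x\<^sub>k\<parallel>\<^sup>2\<close>, so the steps tend to \<open>0\<close>, and with them the distance from \<open>x\<^sub>k\<close> to
  the current fixed point. There are finitely many fixed points, so from some \<open>k\<close> on the current
  one is always the same point (even if \<open>J\<close> keeps changing), and every later step contracts
  towards it. The limit need not be sparse.
\<close>

section \<open>Linear convergence of switched contractions\<close>

lemma finite_imp_separated:
  fixes S :: "'a::metric_space set"
  assumes "finite S"
  obtains d where "0 < d" "\<And>a b. a \<in> S \<Longrightarrow> b \<in> S \<Longrightarrow> dist a b < d \<Longrightarrow> a = b"
proof -
  have "\<forall>a\<in>S. \<exists>d>0. \<forall>b\<in>S. b \<noteq> a \<longrightarrow> d \<le> dist a b"
    using finite_set_avoid[OF assms] by blast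
  then obtain f where f: "\<And>a. a \<in> S \<Longrightarrow> 0 < f a"
    "\<And>a b. a \<in> S \<Longrightarrow> b \<in> S \<Longrightarrow> b \<noteq> a \<Longrightarrow> f a \<le> dist a b"
    by metis
  show thesis
  proof (rule that)
    \<comment> \<open>The inserted \<open>1\<close> keeps the minimum defined when \<open>S\<close>
      is empty.\<close>
    show "0 < Min (insert 1 (f ` S))"
      using assms f(1) by (subst Min_gr_iff) auto
    show "a = b" if "a \<in> S" "b \<in> S" "dist a b < Min (insert 1 (f ` S))" for a b
      using that f(2)[of a b] assms by (force simp: Min_gr_iff)
  qed
qed

lemma converges_linearlyI_eventually:
  fixes x :: "nat \<Rightarrow> 'a::real_normed_vector"
  assumes c: "c < 1"
    and step: "\<And>k. K \<le> k \<Longrightarrow> norm (x (Suc k) - l) \<le> c * norm (x k - l)"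
  shows "converges_linearly x"
proof -
  \<comment> \<open>The rate must be positive, while \<open>c\<close> may be zero or
    negative.\<close>
  define r where "r = max c (1/2)"
  have r: "0 < r" "r < 1" "c \<le> r"
    using c by (auto simp: r_def)
  define B where "B = (\<Sum>k\<le>K. norm (x k - l))"
  \<comment> \<open>Chosen so that \<open>C * r ^ K\<close> is \<open>B + 1\<close>, which exceeds
    all norms up to \<open>K\<close>; the \<open>1\<close> keeps \<open>C\<close> positive when
    \<open>B = 0\<close>.\<close>
  define C where "C = (B + 1) / r ^ K"
  have B: "norm (x k - l) \<le> B" if "k \<le> K" for k
    unfolding B_def using that by (intro member_le_sum) auto
  have "0 \<le> B"
    unfolding B_def by (intro sum_nonneg) auto
  then have "0 < C"
    using r by (simp add: C_def)
  have head: "norm (x k - l) \<le> C * r ^ k" if "k \<le> K" for k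
  proof -
    have "norm (x k - l) \<le> C * r ^ K"
      using B[OF that] r by (simp add: C_def)
    also have "\<dots> \<le> C * r ^ k"
      using \<open>0 < C\<close> r that by (intro mult_left_mono power_decreasing) auto
    finally show ?thesis .
  qed
  have bound: "norm (x k - l) \<le> C * r ^ k" for k
  proof (induction k)
    case 0
    show ?case by (rule head) simp
  next
    case (Suc k)
    show ?case
    proof (cases "Suc k \<le> K")
      case True
      then show ?thesis by (rule head)
    next
      case False
      then have "norm (x (Suc k) - l) \<le> c * norm (x k - l)"
        by (intro step) simp
      also have "\<dots> \<le> r * (C * r ^ k)"
        using r Suc by (intro mult_mono) auto
      finally show ?thesis
        by (simp add: mult_ac)
    qed
  qed
  have "(\<lambda>k. C * r ^ k) \<longlonglongrightarrow> C * 0"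
    using r by (intro tendsto_mult_left LIMSEQ_power_zero) auto
  then have "(\<lambda>k. C * r ^ k) \<longlonglongrightarrow> 0"
    by simp
  then have "(\<lambda>k. x k - l) \<longlonglongrightarrow> 0"
    by (rule Lim_null_comparison[OF always_eventually, rotated]) (simp add: bound)
  then have "x \<longlonglongrightarrow> l"
    by (simp add: LIM_zero_iff)
  with bound \<open>0 < C\<close> r show ?thesis
    unfolding converges_linearly_def by blast
qed

text \<open>Which of the maps acts may change at every step; the vanishing steps are what eventually
  prevents jumps between different fixed points.\<close>

lemma switched_contractions_converge_linearly:
  fixes x :: "nat \<Rightarrow> 'a::real_normed_vector" and T :: "'b \<Rightarrow> 'a \<Rightarrow> 'a"
  assumes fin: "finite (range J)"
    and M: "complete M"
    and c: "0 \<le> c" "c < 1"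
    and maps: "\<And>j u. j \<in> range J \<Longrightarrow> u \<in> M \<Longrightarrow> T j u \<in> M"
    and contr: "\<And>j u v. j \<in> range J \<Longrightarrow> u \<in> M \<Longrightarrow> v \<in> M \<Longrightarrow> dist (T j u) (T j v) \<le> c * dist u v"
    and x0: "x 0 \<in> M"
    and x_Suc: "\<And>k. x (Suc k) = T (J k) (x k)"
    and steps: "(\<lambda>k. x (Suc k) - x k) \<longlonglongrightarrow> 0"
  shows "converges_linearly x"
proof -
  have xM: "x k \<in> M" for k
    by (induction k) (auto simp: x0 x_Suc maps)
  have "\<forall>j\<in>range J. \<exists>q\<in>M. T j q = q"
  proof
    fix j assume "j \<in> range J"
    then have "\<exists>!q\<in>M. T j q = q"
      using x0 maps contr by (intro Banach_fix[OF M _ c]) auto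
    then show "\<exists>q\<in>M. T j q = q" by blast
  qed
  then obtain p where p: "\<And>j. j \<in> range J \<Longrightarrow> p j \<in> M" "\<And>j. j \<in> range J \<Longrightarrow> T j (p j) = p j"
    by metis
  have towards: "dist (x (Suc k)) (p (J k)) \<le> c * dist (x k) (p (J k))" for k
    using contr[of "J k" "x k" "p (J k)"] xM p[of "J k"] by (simp add: x_Suc)
  \<comment> \<open>The triangle inequality through \<open>x (Suc k)\<close>, with the last term
    bounded by \<open>towards\<close>.\<close>
  have near: "(1 - c) * dist (x k) (p (J k)) \<le> norm (x (Suc k) - x k)" for k
    using towards[of k] dist_triangle[of "x k" "p (J k)" "x (Suc k)"]
    by (simp add: algebra_simps dist_norm norm_minus_commute)
  obtain d where d: "0 < d"
    "\<And>a b. a \<in> p ` range J \<Longrightarrow> b \<in> p ` range J \<Longrightarrow> dist a b < d \<Longrightarrow> a = b"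
    using finite_imp_separated[of "p ` range J"] fin by blast
  \<comment> \<open>Successive fixed points will be joined by three distances, each below
    \<open>d / 3\<close>; the factor \<open>1 - c\<close> cancels against the one in
    \<open>near\<close>.\<close>
  have "0 < (1 - c) * (d / 3)" "(1 - c) * (d / 3) \<le> d / 3"
    using c d by (auto intro: mult_left_le_one_le)
  then obtain K where K: "\<And>k. K \<le> k \<Longrightarrow> norm (x (Suc k) - x k) < (1 - c) * (d / 3)"
    using LIMSEQ_D[OF steps] by fastforce
  have close: "dist (x k) (p (J k)) < d / 3" if "K \<le> k" for k
    using order.strict_trans1[OF near K[OF that]] c by simp
  have const: "p (J k) = p (J K)" if "K \<le> k" for k
    using that
  proof (induction k rule: dec_induct)
    case (step k)
    have "dist (x (Suc k)) (x k) < d / 3"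
      using K[OF step(1)] \<open>(1 - c) * (d / 3) \<le> d / 3\<close> by (simp add: dist_norm)
    moreover have "dist (p (J (Suc k))) (p (J k)) \<le>
        dist (x (Suc k)) (p (J (Suc k))) + (dist (x (Suc k)) (x k) + dist (x k) (p (J k)))"
      using dist_triangle3[of "p (J (Suc k))" "p (J k)" "x (Suc k)"]
        dist_triangle[of "x (Suc k)" "p (J k)" "x k"] by linarith
    ultimately have "dist (p (J (Suc k))) (p (J k)) < d"
      using close[of k] close[of "Suc k"] step(1) by simp
    then have "p (J (Suc k)) = p (J k)"
      by (intro d(2)) auto
    with step show ?case by simp
  qed simp
  show ?thesis
  proof (rule converges_linearlyI_eventually[OF c(2)])
    show "norm (x (Suc k) - p (J K)) \<le> c * norm (x k - p (J K))" if "K \<le> k" for k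
      using towards[of k] const[OF that] by (simp add: dist_norm)
  qed
qed

section \<open>Projections onto convex sets and coordinate subspaces\<close>

lemma closest_point_Pythagoras_le:
  fixes S :: "'a::euclidean_space set"
  assumes "convex S" "closed S" "z \<in> S"
  shows "(norm (a - closest_point S a))\<^sup>2 + (norm (z - closest_point S a))\<^sup>2 \<le> (norm (a - z))\<^sup>2"
proof -
  let ?q = "closest_point S a"
  have "(norm (a - z))\<^sup>2 = (norm ((a - ?q) - (z - ?q)))\<^sup>2"
    by simp
  also have "\<dots> = (norm (a - ?q))\<^sup>2 + (norm (z - ?q))\<^sup>2 - 2 * inner (a - ?q) (z - ?q)"
    unfolding power2_norm_eq_inner by (simp add: inner_diff inner_commute)
  \<comment> \<open>The inner product is nonpositive by the variational inequality for the
    projection onto a convex set.\<close>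
  finally show ?thesis
    using closest_point_dot[OF assms, of a] by simp
qed

text \<open>Orthogonal projection onto a coordinate subspace. With \<open>J\<close> as a parameter
  each map is linear, although selecting the largest entries is not.\<close>

definition restrict_vec :: "'N set \<Rightarrow> real ^ 'N \<Rightarrow> real ^ 'N" where
  "restrict_vec J v = (\<chi> i. if i \<in> J then v $ i else 0)"

lemma restrict_vec_nth [simp]: "restrict_vec J v $ i = (if i \<in> J then v $ i else 0)"
  by (simp add: restrict_vec_def)

lemma restrict_vec_diff: "restrict_vec J (u - v) = restrict_vec J u - restrict_vec J v"
  by (simp add: vec_eq_iff)

lemma linear_restrict_vec: "linear (restrict_vec J)"
  by (rule linearI) (simp_all add: vec_eq_iff)

lemma norm_restrict_vec_Pythagoras:
  "(norm (restrict_vec J v))\<^sup>2 + (norm (v - restrict_vec J v))\<^sup>2 = (norm v)\<^sup>2"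
  by (simp add: power2_norm_eq_inner inner_vec_def flip: sum.distrib)
    (rule sum.cong, auto)

lemma restrict_vec_sparse: "card J \<le> s \<Longrightarrow> restrict_vec J v \<in> sparse_vectors s"
  unfolding sparse_vectors_def l0_norm_def
  by (auto intro: order_trans[OF card_mono[of J]])

text \<open>Exchange argument: the common part cancels, and a bijection of \<open>J' - J\<close>
  onto \<open>J - J'\<close> pairs each term with one at least as large.\<close>

lemma sum_le_of_dominated:
  fixes f :: "'a \<Rightarrow> real"
  assumes "finite J" "finite J'" "card J' = card J"
    and dom: "\<And>i j. i \<in> J \<Longrightarrow> j \<in> J' - J \<Longrightarrow> f j \<le> f i"
  shows "sum f J' \<le> sum f J"
proof -
  have "card (J' - J) = card (J - J')"
    using assms by (simp add: card_Diff_subset_Int Int_commute)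
  then obtain h where h: "bij_betw h (J' - J) (J - J')"
    using assms by (meson finite_Diff finite_same_card_bij)
  have "sum f (J' - J) \<le> (\<Sum>j\<in>J' - J. f (h j))"
    using bij_betwE[OF h] dom by (intro sum_mono) auto
  also have "\<dots> = sum f (J - J')"
    by (rule sum.reindex_bij_betw[OF h])
  finally show ?thesis
    using sum.Int_Diff[OF assms(1), of f J'] sum.Int_Diff[OF assms(2), of f J]
    by (simp add: Int_commute)
qed

text \<open>Keeping the largest entries retains the most squared norm and so leaves the smallest
  residual. The free \<open>w\<close> permits comparison with the restriction of an earlier
  iterate.\<close>

lemma restrict_vec_best_approximation:
  fixes v w :: "real ^ 'N"
  assumes "card J' = card J" and "\<forall>i\<in>J. \<forall>j\<in>-J. \<bar>v $ j\<bar> \<le> \<bar>v $ i\<bar>"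
  shows "norm (v - restrict_vec J v) \<le> norm (v - restrict_vec J' w)"
proof -
  have residual: "(norm (v - restrict_vec I v))\<^sup>2 = (norm v)\<^sup>2 - (\<Sum>i\<in>I. (v $ i)\<^sup>2)" for I
  proof -
    have "(norm (restrict_vec I v))\<^sup>2 = (\<Sum>i\<in>UNIV. if i \<in> I then (v $ i)\<^sup>2 else 0)"
      by (simp add: power2_norm_eq_inner inner_vec_def)
        (rule sum.cong, auto simp: power2_eq_square)
    also have "\<dots> = (\<Sum>i\<in>I. (v $ i)\<^sup>2)"
      by (simp add: sum.If_cases)
    finally show ?thesis
      using norm_restrict_vec_Pythagoras[of I v] by simp
  qed
  have "(\<Sum>i\<in>J'. (v $ i)\<^sup>2) \<le> (\<Sum>i\<in>J. (v $ i)\<^sup>2)"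
    using assms by (intro sum_le_of_dominated) (auto simp: abs_le_square_iff)
  then have "(norm (v - restrict_vec J v))\<^sup>2 \<le> (norm (v - restrict_vec J' v))\<^sup>2"
    by (simp add: residual)
  then have "norm (v - restrict_vec J v) \<le> norm (v - restrict_vec J' v)"
    by (rule power2_le_imp_le) simp
  \<comment> \<open>Both residuals agree off \<open>J'\<close>, and on \<open>J'\<close> the left
    one vanishes.\<close>
  also have "\<dots> \<le> norm (v - restrict_vec J' w)"
    by (rule norm_le_componentwise_cart) auto
  finally show ?thesis .
qed

section \<open>Contraction on the null space\<close>

lemma subspace_Null: "subspace (Null A)"
  unfolding Null_def by (rule subspaceI) (auto simp: matrix_vector_right_distrib matrix_vector_mult_scaleR)

text \<open>A nonzero null vector is never supported in \<open>J\<close>, so restriction loses part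
  of it; finite dimension bounds the lost fraction below, and Pythagoras turns this into a factor
  below \<open>1\<close>.\<close>

lemma restrict_vec_contracts_Null:
  fixes A :: "real ^ 'N ^ 'n"
  assumes triv: "sparse_vectors s \<inter> Null A = {0}" and J: "card J \<le> s"
  shows "\<exists>c. 0 \<le> c \<and> c < 1 \<and> (\<forall>u\<in>Null A. norm (restrict_vec J u) \<le> c * norm u)"
proof -
  let ?R = "\<lambda>u. u - restrict_vec J u"
  have lin: "bounded_linear ?R"
    by (intro linear_conv_bounded_linear[THEN iffD1] linear_compose_sub linear_ident linear_restrict_vec)
  have inj: "\<forall>u\<in>Null A. ?R u = 0 \<longrightarrow> u = 0"
  proof (intro ballI impI)
    fix u assume "u \<in> Null A" "?R u = 0"
    then have "u \<in> sparse_vectors s \<inter> Null A"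
      using restrict_vec_sparse[OF J, of u] by simp
    with triv show "u = 0" by blast
  qed
  obtain e where e: "0 < e" "\<And>u. u \<in> Null A \<Longrightarrow> e * norm u \<le> norm (?R u)"
    using injective_imp_isometric[OF closed_subspace[OF subspace_Null] subspace_Null lin inj]
    by (auto simp: mult.commute)
  \<comment> \<open>Pythagoras gives the factor \<open>1 - e\<^sup>2\<close> for squares, which can
    be negative when the null space is trivial.\<close>
  define c where "c = sqrt (max 0 (1 - e\<^sup>2))"
  have "norm (restrict_vec J u) \<le> c * norm u" if "u \<in> Null A" for u
  proof -
    have "(e * norm u)\<^sup>2 \<le> (norm (?R u))\<^sup>2"
      using e that by (intro power_mono) auto
    then have "(norm (restrict_vec J u))\<^sup>2 \<le> (1 - e\<^sup>2) * (norm u)\<^sup>2"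
      using norm_restrict_vec_Pythagoras[of J u] by (simp add: algebra_simps)
    also have "\<dots> \<le> max 0 (1 - e\<^sup>2) * (norm u)\<^sup>2"
      by (intro mult_right_mono) auto
    also have "\<dots> = (c * norm u)\<^sup>2"
      by (simp add: c_def power_mult_distrib)
    finally show ?thesis
      by (rule power2_le_imp_le) (simp add: c_def)
  qed
  moreover have "0 \<le> c" "c < 1"
    using e by (auto simp: c_def)
  ultimately show ?thesis by blast
qed

text \<open>There are only finitely many index sets, so the largest of their factors is still below
  \<open>1\<close>.\<close>

lemma restrict_vec_contracts_Null_uniform:
  fixes A :: "real ^ 'N ^ 'n"
  assumes triv: "sparse_vectors s \<inter> Null A = {0}"
  obtains c where "0 \<le> c" "c < 1"
    "\<And>J u. card J \<le> s \<Longrightarrow> u \<in> Null A \<Longrightarrow> norm (restrict_vec J u) \<le> c * norm u"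
proof -
  obtain f where f: "\<And>J. card J \<le> s \<Longrightarrow> 0 \<le> f J \<and> f J < 1 \<and>
      (\<forall>u\<in>Null A. norm (restrict_vec J u) \<le> f J * norm u)"
    using restrict_vec_contracts_Null[OF triv] by metis
  define c where "c = Max (insert 0 (f ` {J. card J \<le> s}))"
  show thesis
  proof (rule that)
    show "0 \<le> c"
      unfolding c_def by (rule Max_ge) auto
    show "c < 1"
      unfolding c_def using f by (subst Max_less_iff) auto
    show "norm (restrict_vec J u) \<le> c * norm u" if "card J \<le> s" "u \<in> Null A" for J u
    proof -
      have "f J \<le> c"
        unfolding c_def using that by (intro Max_ge) auto
      then show ?thesis
        using f[OF that(1)] that(2) by (meson mult_right_mono norm_ge_zero order_trans)
    qed
  qed
qed

section \<open>The affine space and the iteration\<close>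

lemma convex_affine_solutions: "convex (affine_solutions A b)"
  unfolding affine_solutions_def convex_def
  by (auto simp: matrix_vector_right_distrib matrix_vector_mult_scaleR simp flip: scaleR_left_distrib)

lemma closed_affine_solutions: "closed (affine_solutions A b)"
  unfolding affine_solutions_def
  by (intro closed_Collect_eq continuous_intros matrix_vector_mult_linear_continuous_on)

lemma affine_solutions_diff:
  "u \<in> affine_solutions A b \<Longrightarrow> v \<in> affine_solutions A b \<Longrightarrow> u - v \<in> Null A"
  by (simp add: affine_solutions_def Null_def matrix_vector_mult_diff_distrib)

text \<open>\<open>a\<close> decreases and is bounded below, so it converges; its vanishing
  decrements dominate the squares.\<close>

lemma tendsto_0_of_square_le_decrease:
  fixes a :: "nat \<Rightarrow> real" and z :: "nat \<Rightarrow> 'a::real_normed_vector"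
  assumes nonneg: "\<And>k. 0 \<le> a k" and drop: "\<And>k. a (Suc k) + (norm (z k))\<^sup>2 \<le> a k"
  shows "z \<longlonglongrightarrow> 0"
proof -
  have "decseq a"
    using drop by (intro decseq_SucI) (smt (verit) zero_le_power2)
  then obtain l where "a \<longlonglongrightarrow> l"
    using nonneg decseq_convergent by blast
  then have "(\<lambda>k. a k - a (Suc k)) \<longlonglongrightarrow> l - l"
    by (intro tendsto_diff LIMSEQ_Suc)
  then have lim: "(\<lambda>k. a k - a (Suc k)) \<longlonglongrightarrow> 0"
    by simp
  have "norm ((norm (z k))\<^sup>2) \<le> a k - a (Suc k)" for k
    using drop[of k] by simp
  then have "(\<lambda>k. (norm (z k))\<^sup>2) \<longlonglongrightarrow> 0"
    by (intro Lim_null_comparison[OF always_eventually lim]) simp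
  then show ?thesis
    by (simp add: tendsto_norm_zero_iff)
qed

theorem theorem7:
  fixes A :: "real ^ 'N ^ 'n" and b :: "real ^ 'n" and s :: nat
    and x y :: "nat \<Rightarrow> real ^ 'N"
  assumes "0 < s"
    and "sparse_vectors s \<inter> Null A = {0}"
    and "\<exists>x_star. x_star \<in> sparse_vectors s \<inter> affine_solutions A b"
    and "x 0 \<in> affine_solutions A b"
    and "alternating_projections A b s x y"
  shows "converges_linearly x"
proof -
  let ?M = "affine_solutions A b"
  note M = convex_affine_solutions[of A b] closed_affine_solutions[of A b]
  have "?M \<noteq> {}"
    using assms(4) by blast
  \<comment> \<open>Ties may leave several index sets, so one is chosen for each
    \<open>k\<close>.\<close>
  have "\<forall>k. \<exists>J. y k = restrict_vec J (x k) \<and> card J = min s CARD('N) \<and>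
      (\<forall>i\<in>J. \<forall>j\<in>-J. \<bar>x k $ j\<bar> \<le> \<bar>x k $ i\<bar>)"
    using assms(5) by (auto simp: alternating_projections_def sparse_projections_def restrict_vec_def)
  then obtain J where y: "\<And>k. y k = restrict_vec (J k) (x k)"
    and card_J: "\<And>k. card (J k) = min s CARD('N)"
    and largest: "\<And>k. \<forall>i\<in>J k. \<forall>j\<in>-J k. \<bar>x k $ j\<bar> \<le> \<bar>x k $ i\<bar>"
    by metis
  have x_Suc: "x (Suc k) = closest_point ?M (y k)" for k
    using assms(5) by (simp add: alternating_projections_def)
  have xM: "x k \<in> ?M" for k
    using assms(4) closest_point_in_set[OF M(2) \<open>?M \<noteq> {}\<close>] by (cases k) (auto simp: x_Suc)
  have drop: "(norm (x (Suc k) - y (Suc k)))\<^sup>2 + (norm (x (Suc k) - x k))\<^sup>2 \<le> (norm (x k - y k))\<^sup>2"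
    for k
  proof -
    \<comment> \<open>\<open>y k\<close> is an admissible competitor to the best sparse
      approximation of \<open>x (Suc k)\<close>.\<close>
    have "norm (x (Suc k) - y (Suc k)) \<le> norm (x (Suc k) - y k)"
      unfolding y by (rule restrict_vec_best_approximation[OF _ largest]) (simp add: card_J)
    then have "(norm (x (Suc k) - y (Suc k)))\<^sup>2 \<le> (norm (x (Suc k) - y k))\<^sup>2"
      by (intro power_mono) auto
    \<comment> \<open>Pythagoras for the projection of \<open>y k\<close>, with \<open>x k\<close>
      as the other point of the affine space.\<close>
    moreover have "(norm (x (Suc k) - y k))\<^sup>2 + (norm (x (Suc k) - x k))\<^sup>2 \<le> (norm (x k - y k))\<^sup>2"
      using closest_point_Pythagoras_le[OF M xM, of "y k" k]
      by (simp add: x_Suc norm_minus_commute)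
    ultimately show ?thesis by linarith
  qed
  have steps: "(\<lambda>k. x (Suc k) - x k) \<longlonglongrightarrow> 0"
    by (rule tendsto_0_of_square_le_decrease[where a = "\<lambda>k. (norm (x k - y k))\<^sup>2"])
      (simp, rule drop)
  obtain c where c: "0 \<le> c" "c < 1"
    "\<And>J u. card J \<le> s \<Longrightarrow> u \<in> Null A \<Longrightarrow> norm (restrict_vec J u) \<le> c * norm u"
    using restrict_vec_contracts_Null_uniform[OF assms(2)] by blast
  show ?thesis
  proof (rule switched_contractions_converge_linearly
      [where T = "\<lambda>I u. closest_point ?M (restrict_vec I u)" and J = J and M = ?M])
    show "finite (range J)"
      by simp
    show "complete ?M"
      using M(2) by (simp add: complete_eq_closed)
    show "closest_point ?M (restrict_vec I u) \<in> ?M" for I u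
      by (rule closest_point_in_set[OF M(2) \<open>?M \<noteq> {}\<close>])
    show "dist (closest_point ?M (restrict_vec I u)) (closest_point ?M (restrict_vec I v))
        \<le> c * dist u v" if "I \<in> range J" "u \<in> ?M" "v \<in> ?M" for I u v
    proof -
      \<comment> \<open>The projection onto \<open>?M\<close> is nonexpansive; the contraction comes
        from restricting \<open>u - v\<close>, which lies in the null space.\<close>
      have "dist (closest_point ?M (restrict_vec I u)) (closest_point ?M (restrict_vec I v))
          \<le> norm (restrict_vec I (u - v))"
        using closest_point_lipschitz[OF M \<open>?M \<noteq> {}\<close>] by (simp add: restrict_vec_diff dist_norm)
      also have "\<dots> \<le> c * norm (u - v)"
        using that card_J by (intro c(3) affine_solutions_diff) auto
      finally show ?thesis
        by (simp add: dist_norm)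
    qed
  qed (use c(1,2) assms(4) steps in \<open>auto simp: x_Suc y\<close>)
qed

end
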